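(* If $G$ is an opposable finite simple graph and $H$ is any finite simple graph, then the Cartesian product $G\square H$, the strong product $G\boxtimes H$, the tensor product $G\times H$, the lexicographic product $G\bullet H$, the co-normal product $G*H$, and the homomorphic product $G\ltimes H$ are all opposable.
   Context: All graphs are finite and simple. $N[v]$ denotes the closed neighbourhood of $v$. An opposition of a graph $G$ is an automorphism $f$ of $G$ of order two, in the sense $f\circ f=\mathrm{id}$, such that $f(v)\notin N[v]$ for all $v\in V(G)$. A graph is opposable if it has an opposition (the empty graph is vacuously opposable). Each product has vertex set $V(G)\times V(H)$, and distinct vertices $(g_1,h_1)$ and $(g_2,h_2)$ are adjacent if and only if the following holds: - Cartesian $G\square H$: $(g_1=g_2\wedge h_1h_2\in E(H))\vee(g_1g_2\in E(G)\wedge h_1=h_2)$. - Strong $G\boxtimes H$: $(g_1=g_2\wedge h_1h_2\in E(H))\vee(g_1g_2\in E(G)\wedge h_1=h_2)\vee(g_1g_2\in E(G)\wedge h_1h_2\in E(H))$. - Tensor $G\times H$: $g_1g_2\in E(G)\wedge h_1h_2\in E(H)$. - Lexicographic $G\bullet H$: $g_1g_2\in E(G)\vee(g_1=g_2\wedge h_1h_2\in E(H))$. - Co-normal $G*H$: $g_1g_2\in E(G)\vee h_1h_2\in E(H)$. - Homomorphic $G\ltimes H$: $g_1=g_2\vee(g_1g_2\in E(G)\wedge\neg(h_1h_2\in E(H)))$. *)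

theory Defs
  imports "Graph_Theory.Pair_Digraph" "Graph_Theory.Digraph_Isomorphism"
begin

text \<open>
  A finite simple graph is a \<^locale>\<open>pair_graph\<close>: a finite vertex set with a symmetric,
  loop-free arc relation on it, where the edge \<open>uv\<close> is the pair of arcs \<open>(u, v)\<close>, \<open>(v, u)\<close>.
  The null graph is allowed.
\<close>

definition closed_neighbourhood :: "'a pair_pre_digraph \<Rightarrow> 'a \<Rightarrow> 'a set" where
  "closed_neighbourhood G v = insert v {u. (v, u) \<in> parcs G}"

text \<open>
  Only the restriction of \<open>f\<close> to the vertex set matters; \<open>f\<close> is arbitrary elsewhere.
\<close>

definition graph_automorphism :: "'a pair_pre_digraph \<Rightarrow> ('a \<Rightarrow> 'a) \<Rightarrow> bool" where
  "graph_automorphism G f \<longleftrightarrow>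
     bij_betw f (pverts G) (pverts G) \<and>
     (\<forall>u\<in>pverts G. \<forall>v\<in>pverts G. (f u, f v) \<in> parcs G \<longleftrightarrow> (u, v) \<in> parcs G)"

text \<open>
  The identity is not excluded explicitly by \<open>f \<circ> f = id\<close>, but the last condition
  rules it out unless the graph is null.
\<close>

definition opposition :: "'a pair_pre_digraph \<Rightarrow> ('a \<Rightarrow> 'a) \<Rightarrow> bool" where
  "opposition G f \<longleftrightarrow>
     graph_automorphism G f \<and>
     (\<forall>v\<in>pverts G. f (f v) = v) \<and>
     (\<forall>v\<in>pverts G. f v \<notin> closed_neighbourhood G v)"

definition opposable :: "'a pair_pre_digraph \<Rightarrow> bool" where
  "opposable G \<longleftrightarrow> (\<exists>f. opposition G f)"

text \<open>
  All the products have vertex set \<open>V(G) \<times> V(H)\<close>, and their adjacency conditions are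
  imposed on pairs of distinct vertices only. Distinctness is essential for the homomorphic
  product, whose condition holds for every vertex with itself.
\<close>

definition simple_graph_on :: "'a set \<Rightarrow> ('a \<Rightarrow> 'a \<Rightarrow> bool) \<Rightarrow> 'a pair_pre_digraph" where
  "simple_graph_on V adj =
     \<lparr> pverts = V, parcs = {(x, y). x \<in> V \<and> y \<in> V \<and> x \<noteq> y \<and> adj x y} \<rparr>"

definition cartesian_product ::
    "'a pair_pre_digraph \<Rightarrow> 'b pair_pre_digraph \<Rightarrow> ('a \<times> 'b) pair_pre_digraph" where
  "cartesian_product G H = simple_graph_on (pverts G \<times> pverts H) (\<lambda>(g1, h1) (g2, h2).
     (g1 = g2 \<and> (h1, h2) \<in> parcs H) \<or> ((g1, g2) \<in> parcs G \<and> h1 = h2))"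

definition strong_product ::
    "'a pair_pre_digraph \<Rightarrow> 'b pair_pre_digraph \<Rightarrow> ('a \<times> 'b) pair_pre_digraph" where
  "strong_product G H = simple_graph_on (pverts G \<times> pverts H) (\<lambda>(g1, h1) (g2, h2).
     (g1 = g2 \<and> (h1, h2) \<in> parcs H) \<or> ((g1, g2) \<in> parcs G \<and> h1 = h2) \<or>
     ((g1, g2) \<in> parcs G \<and> (h1, h2) \<in> parcs H))"

definition tensor_product ::
    "'a pair_pre_digraph \<Rightarrow> 'b pair_pre_digraph \<Rightarrow> ('a \<times> 'b) pair_pre_digraph" where
  "tensor_product G H = simple_graph_on (pverts G \<times> pverts H) (\<lambda>(g1, h1) (g2, h2).
     (g1, g2) \<in> parcs G \<and> (h1, h2) \<in> parcs H)"

definition lexicographic_product ::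
    "'a pair_pre_digraph \<Rightarrow> 'b pair_pre_digraph \<Rightarrow> ('a \<times> 'b) pair_pre_digraph" where
  "lexicographic_product G H = simple_graph_on (pverts G \<times> pverts H) (\<lambda>(g1, h1) (g2, h2).
     (g1, g2) \<in> parcs G \<or> (g1 = g2 \<and> (h1, h2) \<in> parcs H))"

definition conormal_product ::
    "'a pair_pre_digraph \<Rightarrow> 'b pair_pre_digraph \<Rightarrow> ('a \<times> 'b) pair_pre_digraph" where
  "conormal_product G H = simple_graph_on (pverts G \<times> pverts H) (\<lambda>(g1, h1) (g2, h2).
     (g1, g2) \<in> parcs G \<or> (h1, h2) \<in> parcs H)"

definition homomorphic_product ::
    "'a pair_pre_digraph \<Rightarrow> 'b pair_pre_digraph \<Rightarrow> ('a \<times> 'b) pair_pre_digraph" where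
  "homomorphic_product G H = simple_graph_on (pverts G \<times> pverts H) (\<lambda>(g1, h1) (g2, h2).
     g1 = g2 \<or> ((g1, g2) \<in> parcs G \<and> \<not> (h1, h2) \<in> parcs H))"

lemma pair_graph_simple_graph_on:
  assumes "finite V" and sym: "\<And>x y. adj x y \<Longrightarrow> adj y x"
  shows "pair_graph (simple_graph_on V adj)"
proof -
  have "parcs (simple_graph_on V adj) \<subseteq> V \<times> V"
    by (auto simp: simple_graph_on_def)
  then have "finite (parcs (simple_graph_on V adj))"
    using assms(1) finite_subset by blast
  then show ?thesis
    using assms(1)
    by unfold_locales
       (auto simp: simple_graph_on_def symmetric_def sym_def intro: sym)
qed

lemma pair_graph_products:
  assumes "pair_graph G" and "pair_graph H"
  shows "pair_graph (cartesian_product G H)"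
    and "pair_graph (strong_product G H)"
    and "pair_graph (tensor_product G H)"
    and "pair_graph (lexicographic_product G H)"
    and "pair_graph (conormal_product G H)"
    and "pair_graph (homomorphic_product G H)"
proof -
  interpret G: pair_graph G by fact
  interpret H: pair_graph H by fact
  have fin: "finite (pverts G \<times> pverts H)"
    by (simp add: G.pair_finite_verts H.pair_finite_verts)
  note symD = G.arcs_symmetric H.arcs_symmetric
  show "pair_graph (cartesian_product G H)"
    and "pair_graph (strong_product G H)"
    and "pair_graph (tensor_product G H)"
    and "pair_graph (lexicographic_product G H)"
    and "pair_graph (conormal_product G H)"
    and "pair_graph (homomorphic_product G H)"
    unfolding cartesian_product_def strong_product_def tensor_product_def
      lexicographic_product_def conormal_product_def homomorphic_product_def
    by (rule pair_graph_simple_graph_on[OF fin]; auto dest: symD)+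
qed

text \<open>
  Agreement with the library's notion of isomorphism, which acts on vertices and arcs separately.
\<close>

lemma graph_automorphism_iff_digraph_isomorphism:
  assumes "pair_wf_digraph G"
  shows "graph_automorphism G f \<longleftrightarrow>
    (\<exists>hom :: ('a, 'a \<times> 'a, 'a, 'a \<times> 'a) digraph_isomorphism.
       pre_digraph.digraph_isomorphism (with_proj G) hom \<and>
       app_iso hom (with_proj G) = with_proj G \<and> iso_verts hom = f)"
    (is "?L \<longleftrightarrow> ?R")
proof
  interpret pair_wf_digraph G by fact
  assume L: ?L
  let ?hom = "\<lparr>iso_verts = f, iso_arcs = map_prod f f, iso_head = snd, iso_tail = fst\<rparr>
    :: ('a, 'a \<times> 'a, 'a, 'a \<times> 'a) digraph_isomorphism"
  have bij: "inj_on f (pverts G)" "f ` pverts G = pverts G"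
    using L by (auto simp: graph_automorphism_def bij_betw_def)
  have arcs: "(f u, f v) \<in> parcs G \<longleftrightarrow> (u, v) \<in> parcs G"
    if "u \<in> pverts G" "v \<in> pverts G" for u v
    using L that by (auto simp: graph_automorphism_def)
  have "map_prod f f ` parcs G = parcs G"
  proof (intro set_eqI iffI)
    fix e assume "e \<in> map_prod f f ` parcs G"
    then show "e \<in> parcs G" using arcs wellformed' by fastforce
  next
    fix e assume e: "e \<in> parcs G"
    obtain a b where ab: "e = (a, b)" by (cases e)
    obtain u v where "u \<in> pverts G" "v \<in> pverts G" "a = f u" "b = f v"
      using e ab bij(2) wellformed' by (metis imageE)
    then show "e \<in> map_prod f f ` parcs G"
      using e ab arcs by (metis imageI map_prod_simp)
  qed
  moreover have "inj_on (map_prod f f) (parcs G)"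
    by (rule inj_on_subset[OF map_prod_inj_on[OF bij(1) bij(1)]]) (auto dest: wellformed')
  ultimately have "digraph_isomorphism ?hom" and "app_iso ?hom (with_proj G) = with_proj G"
    unfolding digraph_isomorphism_def app_iso_def using bij wf_digraph
    by (simp_all add: with_proj_def)
  then show ?R by (intro exI[of _ ?hom] conjI) simp_all
next
  interpret pair_wf_digraph G by fact
  assume ?R
  then obtain hom :: "('a, 'a \<times> 'a, 'a, 'a \<times> 'a) digraph_isomorphism"
    where iso: "digraph_isomorphism hom"
      and app: "app_iso hom (with_proj G) = with_proj G" and f: "iso_verts hom = f"
    by blast
  have V: "f ` pverts G = pverts G" and A: "iso_arcs hom ` parcs G = parcs G"
    and T: "iso_tail hom = fst" and H: "iso_head hom = snd"
    using app f by (auto simp: app_iso_def with_proj_def)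
  have inj: "inj_on f (pverts G)"
    using iso f by (auto simp: digraph_isomorphism_def)
  have im: "iso_arcs hom (u, v) = (f u, f v)" if "(u, v) \<in> parcs G" for u v
  proof -
    have "f (fst (u, v)) = fst (iso_arcs hom (u, v)) \<and> f (snd (u, v)) = snd (iso_arcs hom (u, v))"
      using iso that unfolding digraph_isomorphism_def T H f by blast
    then show ?thesis by (simp add: prod_eq_iff)
  qed
  have "(f u, f v) \<in> parcs G \<longleftrightarrow> (u, v) \<in> parcs G"
    if uv: "u \<in> pverts G" "v \<in> pverts G" for u v
  proof
    assume "(f u, f v) \<in> parcs G"
    then obtain a b where ab: "(a, b) \<in> parcs G" "(f u, f v) = iso_arcs hom (a, b)"
      using A by (metis imageE surj_pair)
    then have "f u = f a" "f v = f b" using im by auto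
    then show "(u, v) \<in> parcs G"
      using inj uv ab(1) wellformed'[OF ab(1)] by (auto dest: inj_onD)
  next
    assume "(u, v) \<in> parcs G"
    then show "(f u, f v) \<in> parcs G" using A im by (metis imageI)
  qed
  then show ?L using V inj by (auto simp: graph_automorphism_def bij_betw_def)
qed

end

theory Submission
  imports Defs
begin

text \<open>
  If \<open>f\<close> is an opposition of \<open>G\<close>, then \<open>(g, h) \<mapsto> (f g, h)\<close> is one of every product: adjacency of
  \<open>(g\<^sub>1, h\<^sub>1)\<close> and \<open>(g\<^sub>2, h\<^sub>2)\<close> depends on \<open>g\<^sub>1\<close> and \<open>g\<^sub>2\<close> only through the conditions \<open>g\<^sub>1 = g\<^sub>2\<close> and
  \<open>g\<^sub>1g\<^sub>2 \<in> E(G)\<close>, which \<open>f\<close> preserves, and in none of the products are two vertices with the same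
  second coordinate adjacent when both conditions fail.
\<close>

lemma opposition_map_prod_simple_graph_on:
  fixes R :: "bool \<Rightarrow> bool \<Rightarrow> 'b \<Rightarrow> 'b \<Rightarrow> bool"
  assumes f: "opposition G f" and R: "\<And>h. h \<in> W \<Longrightarrow> \<not> R False False h h"
  shows "opposition
    (simple_graph_on (pverts G \<times> W)
      (\<lambda>(g1, h1) (g2, h2). R (g1 = g2) ((g1, g2) \<in> parcs G) h1 h2))
    (map_prod f id)"
    (is "opposition ?P ?F")
proof -
  have bij: "bij_betw f (pverts G) (pverts G)"
    and arcs: "\<And>u v. u \<in> pverts G \<Longrightarrow> v \<in> pverts G \<Longrightarrow> (f u, f v) \<in> parcs G \<longleftrightarrow> (u, v) \<in> parcs G"
    and invol: "\<And>v. v \<in> pverts G \<Longrightarrow> f (f v) = v"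
    and nonadj: "\<And>v. v \<in> pverts G \<Longrightarrow> f v \<noteq> v \<and> (v, f v) \<notin> parcs G"
    using f by (auto simp: opposition_def graph_automorphism_def closed_neighbourhood_def)
  have verts: "f v \<in> pverts G" if "v \<in> pverts G" for v
    using bij that by (rule bij_betw_apply)
  \<comment> \<open>As an equivalence this rewrites both the argument \<open>g1 = g2\<close> of
    \<open>R\<close> and the distinctness of product vertices.\<close>
  have inj: "f u = f v \<longleftrightarrow> u = v" if "u \<in> pverts G" "v \<in> pverts G" for u v
    using invol that by metis
  have "bij_betw ?F (pverts ?P) (pverts ?P)"
    by (rule bij_betw_byWitness[where f' = ?F])
       (auto simp: simple_graph_on_def invol verts)
  moreover have "(?F x, ?F y) \<in> parcs ?P \<longleftrightarrow> (x, y) \<in> parcs ?P"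
    if "x \<in> pverts ?P" "y \<in> pverts ?P" for x y
    using that by (auto simp: simple_graph_on_def arcs inj verts)
  moreover have "?F (?F x) = x" if "x \<in> pverts ?P" for x
    using that by (auto simp: simple_graph_on_def invol)
  moreover have "?F x \<notin> closed_neighbourhood ?P x" if v: "x \<in> pverts ?P" for x
  proof -
    obtain g h where x: "x = (g, h)" and g: "g \<in> pverts G" and h: "h \<in> W"
      using v by (auto simp: simple_graph_on_def)
    \<comment> \<open>The first fact separates \<open>?F x\<close> from \<open>x\<close>; the other
      two reduce adjacency of \<open>x\<close> and \<open>?F x\<close> to
      \<open>R False False h h\<close>.\<close>
    then have "f g \<noteq> g" "g \<noteq> f g" "(g, f g) \<notin> parcs G"
      using nonadj by metis+
    then show ?thesis
      using R[OF h] by (simp add: x closed_neighbourhood_def simple_graph_on_def)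
  qed
  ultimately show ?thesis
    unfolding opposition_def graph_automorphism_def by blast
qed

theorem corollary2p7:
  fixes G :: "'a pair_pre_digraph" and H :: "'b pair_pre_digraph"
  assumes "pair_graph G" and "pair_graph H" and "opposable G"
  shows "opposable (cartesian_product G H) \<and>
         opposable (strong_product G H) \<and>
         opposable (tensor_product G H) \<and>
         opposable (lexicographic_product G H) \<and>
         opposable (conormal_product G H) \<and>
         opposable (homomorphic_product G H)"
proof -
  interpret H: pair_graph H by fact
  obtain f where f: "opposition G f"
    using \<open>opposable G\<close> by (auto simp: opposable_def)
  \<comment> \<open>For the co-normal product, \<open>R False False h h\<close> says exactly that
    \<open>H\<close> has a loop at \<open>h\<close>.\<close>
  have loopfree: "(h, h) \<notin> parcs H" for h
    using H.no_loops' by blast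
  \<comment> \<open>In each instance of \<open>R\<close> below, \<open>e\<close> abstracts
    \<open>g1 = g2\<close> and \<open>a\<close> abstracts adjacency of \<open>g1\<close> and
    \<open>g2\<close> in \<open>G\<close>; the remaining goal is that \<open>R\<close> fails when
    both are false and the second coordinates agree.\<close>
  note lift = opposition_map_prod_simple_graph_on[OF f, where W = "pverts H"]
  have "opposition (cartesian_product G H) (map_prod f id)"
    unfolding cartesian_product_def
    by (rule lift[where R = "\<lambda>e a h1 h2. e \<and> (h1, h2) \<in> parcs H \<or> a \<and> h1 = h2"]) simp
  moreover have "opposition (strong_product G H) (map_prod f id)"
    unfolding strong_product_def
    by (rule lift[where R = "\<lambda>e a h1 h2. e \<and> (h1, h2) \<in> parcs H \<or> a \<and> h1 = h2 \<or>
          a \<and> (h1, h2) \<in> parcs H"]) simp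
  moreover have "opposition (tensor_product G H) (map_prod f id)"
    unfolding tensor_product_def
    by (rule lift[where R = "\<lambda>e a h1 h2. a \<and> (h1, h2) \<in> parcs H"]) simp
  moreover have "opposition (lexicographic_product G H) (map_prod f id)"
    unfolding lexicographic_product_def
    by (rule lift[where R = "\<lambda>e a h1 h2. a \<or> e \<and> (h1, h2) \<in> parcs H"]) simp
  moreover have "opposition (conormal_product G H) (map_prod f id)"
    unfolding conormal_product_def
    by (rule lift[where R = "\<lambda>e a h1 h2. a \<or> (h1, h2) \<in> parcs H"]) (simp add: loopfree)
  moreover have "opposition (homomorphic_product G H) (map_prod f id)"
    unfolding homomorphic_product_def
    by (rule lift[where R = "\<lambda>e a h1 h2. e \<or> a \<and> (h1, h2) \<notin> parcs H"]) simp
  ultimately show ?thesis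
    unfolding opposable_def by blast
qed

end
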